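(* Let $(H;\langle\cdot,\cdot\rangle)$ be an inner product space over $\mathbb{K}$, $x,a\in H$ and $r>0$. If $\|x-a\|\le r$, then $$0\le \|x\|+\|a\|-\|x+a\|\le r .$$
   Context: $\mathbb{K}$ denotes $\mathbb{R}$ or $\mathbb{C}$, and $\|x\|=\langle x,x\rangle^{1/2}$. *)

theory Defs
  imports "HOL-Analysis.Inner_Product"
begin

text \<open>
  Real inner product spaces are the library class \<open>real_inner\<close>, where
  \<open>norm x = sqrt (x \<bullet> x)\<close>.  Complex ones are given by the locale below; the inner product
  is linear in its first argument (hence conjugate-linear in the second).
\<close>

locale complex_inner_product_space =
  vector_space scale for scale :: "complex \<Rightarrow> 'a::ab_group_add \<Rightarrow> 'a" +
  fixes ip :: "'a \<Rightarrow> 'a \<Rightarrow> complex"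
  assumes ip_add_left: "ip (x + y) z = ip x z + ip y z"
    and ip_scale_left: "ip (scale c x) y = c * ip x y"
    and ip_commute: "ip x y = cnj (ip y x)"
    and ip_self_nonneg: "0 \<le> Re (ip x x)"
    and ip_self_eq_0_iff: "ip x x = 0 \<longleftrightarrow> x = 0"

text \<open>Conjugate symmetry makes \<open>ip x x\<close> real, so taking its real part loses nothing.\<close>

definition ip_norm :: "('a \<Rightarrow> 'a \<Rightarrow> complex) \<Rightarrow> 'a \<Rightarrow> real"
  where "ip_norm ip x = sqrt (Re (ip x x))"

end

theory Submission
  imports Defs
begin

text \<open>
  Only the triangle inequality is used: \<open>2 x = (x + a) + (x - a)\<close> and \<open>2 a = (x + a) - (x - a)\<close>,
  so both \<open>2 \<parallel>x\<parallel>\<close> and \<open>2 \<parallel>a\<parallel>\<close> are at most \<open>\<parallel>x + a\<parallel> + \<parallel>x - a\<parallel>\<close>; add the two bounds.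
\<close>

lemma triangle_defect_le_diff:
  fixes N :: "'a::ab_group_add \<Rightarrow> real"
  assumes triangle: "\<And>x y. N (x + y) \<le> N x + N y"
    and minus: "\<And>x. N (- x) = N x"
    and double: "\<And>x. N (x + x) = 2 * N x"
  shows "N x + N a - N (x + a) \<le> N (x - a)"
proof -
  have "2 * N x \<le> N (x + a) + N (x - a)"
    using triangle[of "x + a" "x - a"] double[of x] by (simp add: algebra_simps)
  \<comment> \<open>Here the difference enters as \<open>a - x\<close>, the negative of
    \<open>x - a\<close>, so \<open>minus\<close> gives it the same value.\<close>
  moreover have "2 * N a \<le> N (x + a) + N (x - a)"
    using triangle[of "x + a" "a - x"] double[of a] minus[of "x - a"]
    by (simp add: algebra_simps)
  ultimately show ?thesis by simp
qed

context complex_inner_product_space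
begin

lemma ip_add_right: "ip x (y + z) = ip x y + ip x z"
  by (metis complex_cnj_add ip_add_left ip_commute)

lemma ip_scale_right: "ip x (scale c y) = cnj c * ip x y"
  by (metis complex_cnj_mult ip_commute ip_scale_left)

lemma Re_ip_commute: "Re (ip x y) = Re (ip y x)"
  by (metis complex_cnj(1) ip_commute complex.collapse complex.sel(1))

lemma ip_norm_power2: "(ip_norm ip x)\<^sup>2 = Re (ip x x)"
  by (simp add: ip_norm_def ip_self_nonneg)

lemma ip_norm_nonneg: "0 \<le> ip_norm ip x"
  by (simp add: ip_norm_def ip_self_nonneg)

text \<open>Conjugate symmetry makes \<open>ip x x\<close> real, so it vanishes as soon as its real
  part does; definiteness then applies.\<close>

lemma ip_norm_eq_0_iff: "ip_norm ip x = 0 \<longleftrightarrow> x = 0"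
proof -
  have "Im (ip x x) = 0"
    using arg_cong[OF ip_commute[of x x], of Im] by simp
  then have "ip_norm ip x = 0 \<longleftrightarrow> ip x x = 0"
    by (simp add: ip_norm_def complex_eq_iff)
  then show ?thesis by (simp add: ip_self_eq_0_iff)
qed

lemma ip_norm_scale: "ip_norm ip (scale c x) = cmod c * ip_norm ip x"
proof -
  have "ip (scale c x) (scale c x) = of_real ((cmod c)\<^sup>2) * ip x x"
    by (simp add: ip_scale_left ip_scale_right complex_norm_square mult_ac del: of_real_power)
  then show ?thesis
    by (simp add: ip_norm_def real_sqrt_mult)
qed

text \<open>Cauchy-Schwarz for the real part, the only part that enters the expansion of
  \<open>ip (x + y) (x + y)\<close>. It follows from nonnegativity of \<open>ip\<close> on the
  diagonal at one suitable vector.\<close>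

lemma Re_ip_le_ip_norm: "Re (ip x y) \<le> ip_norm ip x * ip_norm ip y"
proof (cases "x = 0 \<or> y = 0")
  case True
  then have "ip x y = 0"
    using ip_scale_left[of 0 x y] ip_scale_right[of x 0 y] by auto
  then show ?thesis by (simp add: ip_norm_nonneg)
next
  case False
  define n m where "n = ip_norm ip x" and "m = ip_norm ip y"
  have pos: "n * m > 0"
    using False ip_norm_nonneg ip_norm_eq_0_iff
    by (simp add: n_def m_def less_le)
  \<comment> \<open>Each vector is weighted by the norm of the other, so both summands have norm
    \<open>n * m\<close> and the two square terms below agree. The sign sits inside
    \<open>of_real (- n)\<close> so that additivity and homogeneity alone expand the
    product.\<close>
  let ?v = "scale (of_real m) x + scale (of_real (- n)) y"
  have "Re (ip ?v ?v) = m\<^sup>2 * Re (ip x x) - 2 * (n * m) * Re (ip x y) + n\<^sup>2 * Re (ip y y)"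
    using Re_ip_commute[of y x]
    by (simp add: ip_add_left ip_add_right ip_scale_left ip_scale_right power2_eq_square
        algebra_simps del: of_real_minus scale_minus_left)
  also have "\<dots> = 2 * (n * m) * (n * m - Re (ip x y))"
    by (simp add: n_def m_def flip: ip_norm_power2) (simp add: power2_eq_square algebra_simps)
  finally have "0 \<le> 2 * (n * m) * (n * m - Re (ip x y))"
    using ip_self_nonneg[of ?v] by simp
  then show ?thesis
    \<comment> \<open>The positive factor \<open>2 * (n * m)\<close> cancels; this is why zero
      vectors were split off.\<close>
    using pos mult_le_cancel_left_pos[of "2 * (n * m)" 0 "n * m - Re (ip x y)"]
    by (simp flip: n_def m_def)
qed

text \<open>After squaring, the two sides differ only in the cross term, which
  \<open>Re_ip_le_ip_norm\<close> bounds.\<close>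

lemma ip_norm_triangle: "ip_norm ip (x + y) \<le> ip_norm ip x + ip_norm ip y"
proof (rule power2_le_imp_le)
  have "(ip_norm ip (x + y))\<^sup>2 = Re (ip x x) + 2 * Re (ip x y) + Re (ip y y)"
    using Re_ip_commute[of y x] by (simp add: ip_norm_power2 ip_add_left ip_add_right)
  also have "\<dots> \<le> (ip_norm ip x + ip_norm ip y)\<^sup>2"
    using Re_ip_le_ip_norm[of x y] by (simp add: power2_sum ip_norm_power2)
  finally show "(ip_norm ip (x + y))\<^sup>2 \<le> (ip_norm ip x + ip_norm ip y)\<^sup>2" .
qed (simp add: ip_norm_nonneg)

lemma ip_norm_minus: "ip_norm ip (- x) = ip_norm ip x"
  using ip_norm_scale[of "-1" x] by simp

lemma ip_norm_double: "ip_norm ip (x + x) = 2 * ip_norm ip x"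
  using ip_norm_scale[of 2 x] scale_left_distrib[of 1 1 x] by simp

end

theorem proposition1:
  fixes scale :: "complex \<Rightarrow> 'c::ab_group_add \<Rightarrow> 'c"
    and ip :: "'c \<Rightarrow> 'c \<Rightarrow> complex"
  shows
    "(\<forall>(x::'h::real_inner) (a::'h) (r::real). r > 0 \<longrightarrow> norm (x - a) \<le> r \<longrightarrow>
        0 \<le> norm x + norm a - norm (x + a) \<and> norm x + norm a - norm (x + a) \<le> r) \<and>
     (complex_inner_product_space scale ip \<longrightarrow>
       (\<forall>(x::'c) (a::'c) (r::real). r > 0 \<longrightarrow> ip_norm ip (x - a) \<le> r \<longrightarrow>
        0 \<le> ip_norm ip x + ip_norm ip a - ip_norm ip (x + a) \<and>
        ip_norm ip x + ip_norm ip a - ip_norm ip (x + a) \<le> r))"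
proof (intro conjI impI allI)
  fix x a :: 'h and r :: real
  assume "norm (x - a) \<le> r"
  moreover have "norm x + norm a - norm (x + a) \<le> norm (x - a)"
  proof (rule triangle_defect_le_diff)
    show "norm (y + y) = 2 * norm y" for y :: 'h
      by (simp flip: scaleR_2)
  qed (simp_all add: norm_triangle_ineq)
  ultimately show "norm x + norm a - norm (x + a) \<le> r" by simp
  show "0 \<le> norm x + norm a - norm (x + a)"
    using norm_triangle_ineq[of x a] by simp
next
  fix x a :: 'c and r :: real
  assume "complex_inner_product_space scale ip"
  \<comment> \<open>The locale is a premise of the statement, so its lemmas become available only
    through this local interpretation.\<close>
  then interpret complex_inner_product_space scale ip .
  show "0 \<le> ip_norm ip x + ip_norm ip a - ip_norm ip (x + a)"
    using ip_norm_triangle[of x a] by simp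
  assume "ip_norm ip (x - a) \<le> r"
  then show "ip_norm ip x + ip_norm ip a - ip_norm ip (x + a) \<le> r"
    using triangle_defect_le_diff[of "ip_norm ip", OF ip_norm_triangle ip_norm_minus ip_norm_double]
    by (meson order_trans)
qed

end
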